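(* Let $X_1,X_2,\dots$ be i.i.d. from $P^*\in\mathcal P_{\theta^*}$, let $(M_n^\theta)_{n\ge1}$ be an e-process under $\theta$ for each $\theta\in\Theta$, and for each $n$ let $\tilde\theta_n^{(E)}\in\arg\min_{\theta\in\Theta}M_n^\theta$ be an ME-estimator. Let $1=n_1<n_2<\dots$ be a sequence of integers, and let $\alpha_1>\alpha_2>\dots$ be a sequence of positive numbers converging to $0$. Denote by $t(n)$ the integer $t$ satisfying $n\in[n_t,n_{t+1})$, and define $$\mathrm{CS}_n^*=\{\theta\in\Theta: M_n^\theta\le 1/\alpha_{t(n)}\}.$$ Then the sequence $(\mathrm{CS}_n^* )$ is almost sure for $\theta^*$, i.e. $$P^*(\theta^*\in\mathrm{CS}_n^*\text{ for all but finitely many }n)=1,$$ and it also contains the ME-estimators for all but finitely many $n$ almost surely: $$P^*(\tilde\theta_n^{(E)}\in\mathrm{CS}_n^*\text{ for all but finitely many }n)=1.$$ Consequently, for any sequence $(r_n)$ of positive numbers, $$P^*\big(|\tilde\theta_n^{(E)}-\theta^*|=\mathcal O(r_n)\,\big|\,\operatorname{diam}(\mathrm{CS}_n^* )=\mathcal O(r_n)\big)=1,$$ $$P^*\big(|\tilde\theta_n^{(E)}-\theta^*|=o(r_n)\,\big|\,\operatorname{diam}(\mathrm{CS}_n^* )=o(r_n)\big)=1.$$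
   Context: $\Theta$ is a parameter space, with the distance between $\theta,\theta'$ written $|\theta-\theta'|$; $\operatorname{diam}(I)=\sup_{\theta,\theta'\in I}|\theta-\theta'|$. For each $\theta\in\Theta$, $\mathcal P_\theta$ is a set of data-generating distributions; $\mathbb E_\theta$ in a statement means that the statement holds under i.i.d. data from every $P\in\mathcal P_\theta$. The observed data are i.i.d. from an unknown $P^*\in\mathcal P_{\theta^*}$, $\theta^*\in\Theta$; $P^*(\cdot)$ also denotes probability under this i.i.d. law. A sequence $(M_n^\theta)_{n\ge1}$ of nonnegative statistics, $M_n^\theta$ depending on $X_1,\dots,X_n$, is an e-process under $\theta$ if $\mathbb E_\theta M_\tau^\theta\le1$ for any stopping time $\tau$ of the data filtration (with $M_\infty^\theta:=\limsup_n M_n^\theta$). An ME-estimator is any element of $\arg\min_{\theta\in\Theta}M_n^\theta$, which is assumed nonempty (ties broken arbitrarily). A sequence of random sets $(I_n)_{n\ge1}$ is a sequence of almost sure confidence sets for a non-random element $x$ (is "almost sure for $x$") if with probability 1 there exists $N>1$ with $x\in\bigcap_{n=N}^\infty I_n$. All events in question are assumed measurable. $P^*(A\mid B)=1$ is understood as $P^*(B\cap A^c)=0$ (vacuous if $P^*(B)=0$). *)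

theory Defs
  imports "HOL-Probability.Probability" "HOL-Library.Landau_Symbols"
begin

text \<open>
  Observations take values in a measurable space \<open>S\<close>. Data sequences are indexed by the positive
  integers, i.e. they are points of \<open>PiM {1..} (\<lambda>_. S)\<close>.
\<close>

definition iid_law :: "'a measure \<Rightarrow> (nat \<Rightarrow> 'a) measure" where
  "iid_law P = PiM {1..} (\<lambda>_. P)"

definition iid_from :: "'w measure \<Rightarrow> (nat \<Rightarrow> 'w \<Rightarrow> 'a) \<Rightarrow> 'a measure \<Rightarrow> bool" where
  "iid_from W X P \<longleftrightarrow> prob_space W \<and> prob_space.indep_vars W (\<lambda>_. P) X {1..} \<and>
     (\<forall>i\<ge>1. distr W P (X i) = P)"

definition data :: "(nat \<Rightarrow> 'w \<Rightarrow> 'a) \<Rightarrow> 'w \<Rightarrow> (nat \<Rightarrow> 'a)" where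
  "data X w = (\<lambda>i\<in>{1..}. X i w)"

text \<open>
  The \<open>\<sigma>\<close>-algebra generated by the first \<open>t\<close> coordinates; for \<open>t = \<infinity>\<close> it is generated by all of
  them. Time is \<open>enat\<close> because stopping times may be infinite.
\<close>

definition data_filtration :: "'a measure \<Rightarrow> enat \<Rightarrow> (nat \<Rightarrow> 'a) measure" where
  "data_filtration S t =
     vimage_algebra (space (PiM {1..} (\<lambda>_. S)))
       (\<lambda>x. restrict x {i. 1 \<le> i \<and> enat i \<le> t})
       (PiM {i. 1 \<le> i \<and> enat i \<le> t} (\<lambda>_. S))"

definition stopped_value :: "(nat \<Rightarrow> 'b \<Rightarrow> ennreal) \<Rightarrow> ('b \<Rightarrow> enat) \<Rightarrow> 'b \<Rightarrow> ennreal" where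
  "stopped_value M \<tau> x =
     (case \<tau> x of enat n \<Rightarrow> M n x | \<infinity> \<Rightarrow> limsup (\<lambda>n. M n x))"

text \<open>
  \<open>Q\<close> is the set of data-generating distributions belonging to one parameter value. Since the process
  starts at time 1, so do the stopping times; \<open>M 0\<close> is irrelevant. Values in \<open>[0, \<infinity>]\<close> are allowed.
\<close>

definition e_process ::
  "'a measure \<Rightarrow> 'a measure set \<Rightarrow> (nat \<Rightarrow> (nat \<Rightarrow> 'a) \<Rightarrow> ennreal) \<Rightarrow> bool" where
  "e_process S Q M \<longleftrightarrow>
     (\<forall>n\<ge>1. M n \<in> borel_measurable (data_filtration S (enat n))) \<and>
     (\<forall>P\<in>Q. \<forall>\<tau>. stopping_time (data_filtration S) \<tau> \<and> (\<forall>x. 1 \<le> \<tau> x) \<longrightarrow>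
        (\<integral>\<^sup>+ x. stopped_value M \<tau> x \<partial>iid_law P) \<le> 1)"

definition block_index :: "(nat \<Rightarrow> nat) \<Rightarrow> nat \<Rightarrow> nat" where
  "block_index ns n = (THE t. 1 \<le> t \<and> n \<in> {ns t..<ns (t + 1)})"

definition CS_star ::
  "'p set \<Rightarrow> ('p \<Rightarrow> nat \<Rightarrow> 'b \<Rightarrow> ennreal) \<Rightarrow> (nat \<Rightarrow> nat) \<Rightarrow> (nat \<Rightarrow> real) \<Rightarrow> nat \<Rightarrow> 'b \<Rightarrow> 'p set"
  where
  "CS_star \<Theta> M ns \<alpha> n x = {\<theta>\<in>\<Theta>. M \<theta> n x \<le> ennreal (1 / \<alpha> (block_index ns n))}"

definition almost_sure_confidence_sets ::
  "'w measure \<Rightarrow> (nat \<Rightarrow> 'w \<Rightarrow> 'p set) \<Rightarrow> 'p \<Rightarrow> bool" where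
  "almost_sure_confidence_sets W I x \<longleftrightarrow> (AE w in W. \<exists>N>1. x \<in> (\<Inter>n\<in>{N..}. I n w))"

text \<open>
  The diameter is \<open>ennreal\<close>-valued: the library's real-valued \<open>diameter\<close> carries no information for
  unbounded sets. Consequently \<open>O\<close> and \<open>o\<close> are restated for \<open>ennreal\<close>-valued sequences; infinite
  values are possible for finitely many indices only.
\<close>

definition ediam :: "'p::metric_space set \<Rightarrow> ennreal" where
  "ediam I = (SUP \<theta>\<in>I. SUP \<theta>'\<in>I. ennreal (dist \<theta> \<theta>'))"

definition ennreal_bigo :: "(nat \<Rightarrow> ennreal) \<Rightarrow> (nat \<Rightarrow> real) \<Rightarrow> bool" where
  "ennreal_bigo f r \<longleftrightarrow> (\<exists>c>0. \<forall>\<^sub>F n in sequentially. f n \<le> ennreal (c * \<bar>r n\<bar>))"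

definition ennreal_smallo :: "(nat \<Rightarrow> ennreal) \<Rightarrow> (nat \<Rightarrow> real) \<Rightarrow> bool" where
  "ennreal_smallo f r \<longleftrightarrow> (\<forall>c>0. \<forall>\<^sub>F n in sequentially. f n \<le> ennreal (c * \<bar>r n\<bar>))"

end

theory Submission
  imports Defs
begin

text \<open>
  Stopping an e-process when it first exceeds \<open>k\<close> gives Ville's inequality: it ever does so with
  probability at most \<open>1 / k\<close>. Hence the true parameter's e-process is almost surely bounded, whereas
  the thresholds \<open>1 / \<alpha> (block_index ns n)\<close> tend to infinity, so the truth is eventually always covered.
  A minimiser of the e-process lies below the truth and is covered with it.
\<close>

section \<open>Measurability along the data filtration\<close>

lemma space_data_filtration: "space (data_filtration S t) = space (PiM {1..} (\<lambda>_. S))"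
  by (simp add: data_filtration_def)

text \<open>Restriction to the first \<open>s\<close> coordinates factors through restriction to the
  first \<open>t\<close>. The form with the identity map lets \<open>measurable_compose\<close>
  carry an earlier statistic to a later time.\<close>

lemma measurable_data_filtration_mono:
  assumes "s \<le> t"
  shows "(\<lambda>x. x) \<in> measurable (data_filtration S t) (data_filtration S s)"
proof -
  let ?I = "\<lambda>t. {i::nat. 1 \<le> i \<and> enat i \<le> t}"
  have "(\<lambda>x. restrict x (?I t)) \<in> measurable (data_filtration S t) (PiM (?I t) (\<lambda>_. S))"
    unfolding data_filtration_def
    by (rule measurable_vimage_algebra1) (auto simp: space_PiM PiE_iff)
  moreover have sub: "?I s \<subseteq> ?I t"
    using assms by (auto intro: order_trans)
  then have "(\<lambda>y. restrict y (?I s)) \<in> measurable (PiM (?I t) (\<lambda>_. S)) (PiM (?I s) (\<lambda>_. S))"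
    by (rule measurable_restrict_subset)
  ultimately have "(\<lambda>x. restrict (restrict x (?I t)) (?I s))
      \<in> measurable (data_filtration S t) (PiM (?I s) (\<lambda>_. S))"
    by (rule measurable_compose)
  moreover have "restrict (restrict x (?I t)) (?I s) = restrict x (?I s)" for x :: "nat \<Rightarrow> 'a"
    using sub by (simp add: Int_absorb1)
  ultimately have "(\<lambda>x. restrict x (?I s))
      \<in> measurable (data_filtration S t) (PiM (?I s) (\<lambda>_. S))"
    by simp
  then show ?thesis
    by (subst (2) data_filtration_def) (rule measurable_vimage_algebra2, auto simp: space_data_filtration)
qed

text \<open>The filtration is built from \<open>S\<close> and the law from \<open>P\<close>; since
  their sigma-algebras agree, every coordinate restriction is measurable for the law as
  well.\<close>

lemma measurable_iid_law_data_filtration: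
  assumes "sets P = sets S"
  shows "(\<lambda>x. x) \<in> measurable (iid_law P) (data_filtration S t)"
proof -
  have *: "sets (iid_law P) = sets (PiM {1..} (\<lambda>_. S))"
    unfolding iid_law_def by (rule sets_PiM_cong) (auto simp: assms)
  have "(\<lambda>x. x) \<in> measurable (PiM {1..} (\<lambda>_. S)) (data_filtration S t)"
    unfolding data_filtration_def
    by (rule measurable_vimage_algebra2) (auto intro!: measurable_restrict_subset)
  then show ?thesis
    by (simp cong: measurable_cong_sets add: *)
qed

section \<open>Hitting times and Ville's inequality\<close>

definition hitting_above :: "(nat \<Rightarrow> 'b \<Rightarrow> ennreal) \<Rightarrow> ennreal \<Rightarrow> 'b \<Rightarrow> enat" where
  "hitting_above M k x =
     (if \<exists>n\<ge>1. k < M n x then enat (LEAST n. 1 \<le> n \<and> k < M n x) else \<infinity>)"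

text \<open>This is the side condition that \<open>e_process\<close> puts on stopping times, and the
  reason why the search for an exceedance starts at index 1.\<close>

lemma one_le_hitting_above: "1 \<le> hitting_above M k x"
proof (cases "\<exists>n\<ge>1. k < M n x")
  case True
  then have "1 \<le> (LEAST n. 1 \<le> n \<and> k < M n x)"
    by (metis (mono_tags, lifting) LeastI)
  with True show ?thesis
    by (simp add: hitting_above_def one_enat_def)
qed (auto simp: hitting_above_def)

lemma hitting_above_le_enat_iff:
  "hitting_above M k x \<le> enat m \<longleftrightarrow> (\<exists>n\<in>{1..m}. k < M n x)"
proof
  assume h: "hitting_above M k x \<le> enat m"
  then have ex: "\<exists>n. 1 \<le> n \<and> k < M n x"
    by (auto simp: hitting_above_def split: if_splits)
  from LeastI_ex[OF this] h show "\<exists>n\<in>{1..m}. k < M n x"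
    using ex by (auto simp: hitting_above_def)
next
  assume "\<exists>n\<in>{1..m}. k < M n x"
  then obtain n where n: "1 \<le> n \<and> k < M n x" "n \<le> m"
    by auto
  from Least_le[of "\<lambda>n. 1 \<le> n \<and> k < M n x", OF n(1)] n show "hitting_above M k x \<le> enat m"
    by (auto simp: hitting_above_def)
qed

lemma less_stopped_value_hitting_above:
  assumes "1 \<le> n" "k < M n x"
  shows "k < stopped_value M (hitting_above M k) x"
  using LeastI[of "\<lambda>n. 1 \<le> n \<and> k < M n x" n] assms
  by (auto simp: stopped_value_def hitting_above_def)

text \<open>Having stopped by a finite time \<open>m\<close> is a finite union of exceedance events
  at times up to \<open>m\<close>, each already observable at \<open>m\<close>. At infinite time the
  event is the whole space.\<close>

lemma stopping_time_hitting_above: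
  assumes "\<And>n. 1 \<le> n \<Longrightarrow> M n \<in> borel_measurable (data_filtration S (enat n))"
  shows "stopping_time (data_filtration S) (hitting_above M k)"
  unfolding stopping_time_def
proof
  fix t :: enat
  show "Measurable.pred (data_filtration S t) (\<lambda>x. hitting_above M k x \<le> t)"
  proof (cases t)
    case (enat m)
    have [measurable]: "M n \<in> borel_measurable (data_filtration S (enat m))" if "n \<in> {1..m}" for n
      using measurable_compose[OF measurable_data_filtration_mono assms] that by auto
    show ?thesis
      unfolding enat hitting_above_le_enat_iff by measurable
  qed simp
qed

text \<open>This is Markov's inequality for the stopped value, which exceeds \<open>k\<close> on the
  event and has expectation at most 1. The product form avoids dividing by \<open>k\<close>, which
  may be 0 or infinite.\<close>

lemma e_process_Ville:
  assumes e: "e_process S Q M" and P: "P \<in> Q"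
  shows "k * emeasure (iid_law P) {x \<in> space (iid_law P). \<exists>n\<ge>1. k < M n x} \<le> 1"
proof -
  define A where "A = {x \<in> space (iid_law P). \<exists>n\<ge>1. k < M n x}"
  have stopped: "k \<le> stopped_value M (hitting_above M k) x" if "x \<in> A" for x
  proof -
    obtain n where "1 \<le> n" "k < M n x"
      using \<open>x \<in> A\<close> unfolding A_def by blast
    then show ?thesis
      by (rule less_imp_le[OF less_stopped_value_hitting_above[of n k M x]])
  qed
  have "k * emeasure (iid_law P) A \<le> 1"
  proof (cases "A \<in> sets (iid_law P)")
    case True
    have "k * emeasure (iid_law P) A = (\<integral>\<^sup>+x. k * indicator A x \<partial>iid_law P)"
      by (rule nn_integral_cmult_indicator[OF True, symmetric])
    \<comment> \<open>\<open>nn_integral\<close> is monotone for arbitrary functions, so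
      measurability of the stopped value does not have to be shown.\<close>
    also have "\<dots> \<le> (\<integral>\<^sup>+x. stopped_value M (hitting_above M k) x \<partial>iid_law P)"
      using stopped by (intro nn_integral_mono) (simp add: indicator_def)
    also have "\<dots> \<le> 1"
      using e P stopping_time_hitting_above[of M S k] one_le_hitting_above[of M k]
      unfolding e_process_def by blast
    finally show ?thesis .
  \<comment> \<open>By convention \<open>emeasure\<close> is 0 outside the sigma-algebra, so the
    bound is trivial there.\<close>
  qed (simp add: emeasure_notin_sets)
  then show ?thesis
    by (simp only: A_def)
qed

text \<open>An unbounded path exceeds every level \<open>K\<close>, so by Ville's inequality
  \<open>K\<close> times the measure of such paths is at most 1 for all \<open>K\<close>; this
  forces measure 0.\<close>

lemma AE_e_process_bounded:
  assumes e: "e_process S Q M" and P: "P \<in> Q" "sets P = sets S"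
  shows "AE x in iid_law P. \<exists>K. \<forall>n\<ge>1. M n x \<le> of_nat K"
proof (rule AE_I)
  define A where "A K = {x \<in> space (iid_law P). \<exists>n\<ge>1. of_nat K < M n x}" for K :: nat
  have [measurable]: "M n \<in> borel_measurable (iid_law P)" if "n \<ge> 1" for n
    using measurable_compose[OF measurable_iid_law_data_filtration[OF P(2)]] e that
    unfolding e_process_def by blast
  have A: "A K \<in> sets (iid_law P)" for K
    unfolding A_def by measurable
  show "{x \<in> space (iid_law P). \<not> (\<exists>K. \<forall>n\<ge>1. M n x \<le> of_nat K)} \<subseteq> (\<Inter>K. A K)"
    by (auto simp: A_def not_le)
  show "(\<Inter>K. A K) \<in> sets (iid_law P)"
    using A by auto
  have bound: "of_nat K * emeasure (iid_law P) (\<Inter>K. A K) \<le> 1" for K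
  proof -
    have "of_nat K * emeasure (iid_law P) (\<Inter>K. A K) \<le> of_nat K * emeasure (iid_law P) (A K)"
      using A by (intro mult_left_mono emeasure_mono) auto
    also have "\<dots> \<le> 1"
      unfolding A_def by (rule e_process_Ville[OF e P(1)])
    finally show ?thesis .
  qed
  show "emeasure (iid_law P) (\<Inter>K. A K) = 0"
  proof (rule ccontr)
    assume nz: "emeasure (iid_law P) (\<Inter>K. A K) \<noteq> 0"
    show False
    \<comment> \<open>The bound at \<open>K = 1\<close> excludes infinite measure, and the
      Archimedean property excludes a positive real one.\<close>
    proof (cases "emeasure (iid_law P) (\<Inter>K. A K)")
      case top
      with bound[of 1] show False
        by (simp add: top_unique)
    next
      case (real c)
      with nz have "0 < c"
        by (cases "c = 0") auto
      then obtain K :: nat where "1 < of_nat K * c"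
        using reals_Archimedean3 by blast
      moreover have "of_nat K * c \<le> 1"
        using bound[of K] real
        by (simp add: ennreal_of_nat_eq_real_of_nat ennreal_mult[symmetric])
      ultimately show False
        by simp
    qed
  qed
qed

section \<open>From the sequence space to the observed data\<close>

lemma iid_from_distr_data:
  assumes "iid_from W X P"
  shows "data X \<in> measurable W (PiM {1..} (\<lambda>_. P))"
    and "distr W (PiM {1..} (\<lambda>_. P)) (data X) = iid_law P"
proof -
  interpret prob_space W
    using assms by (simp add: iid_from_def)
  have ind: "indep_vars (\<lambda>_. P) X {1..}" and d: "\<And>i. 1 \<le> i \<Longrightarrow> distr W P (X i) = P"
    using assms by (auto simp: iid_from_def)
  have rv: "random_variable P (X i)" if "i \<in> {1..}" for i
    using ind that by (auto simp: indep_vars_def)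
  have eq: "data X = (\<lambda>w. \<lambda>i\<in>{1..}. X i w)"
    by (auto simp: data_def fun_eq_iff)
  show "data X \<in> measurable W (PiM {1..} (\<lambda>_. P))"
    unfolding eq by (rule measurable_restrict) (rule rv)
  \<comment> \<open>Independence turns the joint law into the product of the marginals, each of
    which is \<open>P\<close>.\<close>
  have "distr W (PiM {1..} (\<lambda>_. P)) (data X) = PiM {1..} (\<lambda>i. distr W P (X i))"
    unfolding eq using ind by (subst (asm) indep_vars_iff_distr_eq_PiM') (auto intro: rv)
  also have "\<dots> = iid_law P"
    unfolding iid_law_def by (rule PiM_cong) (auto simp: d)
  finally show "distr W (PiM {1..} (\<lambda>_. P)) (data X) = iid_law P" .
qed

section \<open>Blocks and thresholds\<close>

lemma block_index_ge:
  assumes ns: "ns 1 = 1" "strict_mono_on {1..} ns" and T: "1 \<le> T" "ns T \<le> n"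
  shows "T \<le> block_index ns n"
proof -
  have mono: "ns s < ns t" if "1 \<le> s" "s < t" for s t
    using ns(2) that by (auto simp: strict_mono_on_def)
  \<comment> \<open>Strictly increasing integers starting from 1 dominate their index. This bounds
    the candidates for the block of \<open>n\<close>, so that a greatest one exists.\<close>
  have ge: "t \<le> ns t" if "1 \<le> t" for t
    using that
  proof (induction t rule: dec_induct)
    case (step t)
    then show ?case
      using mono[of t "Suc t"] by simp
  qed (use ns in simp)
  have "\<exists>t\<ge>T. n \<in> {ns t..<ns (t + 1)}"
  proof -
    \<comment> \<open>Searching only from \<open>T\<close> onwards builds the claimed lower bound
      into the witness.\<close>
    define t where "t = (GREATEST t. T \<le> t \<and> ns t \<le> n)"
    have bd: "s \<le> n" if "T \<le> s \<and> ns s \<le> n" for s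
      using that ge[of s] T by linarith
    have t: "T \<le> t \<and> ns t \<le> n"
      unfolding t_def by (rule GreatestI_nat[where k = T and b = n]) (use T bd in auto)
    have "\<not> (T \<le> t + 1 \<and> ns (t + 1) \<le> n)"
      using Greatest_le_nat[where k = "t + 1" and b = n and P = "\<lambda>t. T \<le> t \<and> ns t \<le> n"] bd
      unfolding t_def by fastforce
    with t show ?thesis
      by auto
  qed
  then obtain t where t: "T \<le> t" "ns t \<le> n" "n < ns (t + 1)"
    by auto
  have "block_index ns n = t"
    unfolding block_index_def
  proof (rule the_equality)
    fix s
    assume s: "1 \<le> s \<and> n \<in> {ns s..<ns (s + 1)}"
    \<comment> \<open>Blocks are disjoint: \<open>s < t\<close> would give
      \<open>n < ns (s + 1)\<close> and \<open>ns (s + 1) \<le> ns t \<le> n\<close>. The other case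
      is symmetric.\<close>
    have "\<not> s < t"
      using mono[of "s + 1" t] s t by (cases "s + 1 = t") auto
    moreover have "\<not> t < s"
      using mono[of "t + 1" s] s t by (cases "t + 1 = s") auto
    ultimately show "s = t"
      by simp
  qed (use t T in auto)
  with t show ?thesis
    by simp
qed

lemma eventually_le_inverse_block_level:
  assumes ns: "ns 1 = 1" "strict_mono_on {1..} ns"
    and \<alpha>: "\<And>t. 1 \<le> t \<Longrightarrow> 0 < \<alpha> t" "\<alpha> \<longlonglongrightarrow> 0"
  shows "\<forall>\<^sub>F n in sequentially. of_nat K \<le> ennreal (1 / \<alpha> (block_index ns n))"
proof -
  \<comment> \<open>\<open>Suc K\<close> keeps the denominator positive when
    \<open>K = 0\<close>.\<close>
  have "\<forall>\<^sub>F t in sequentially. \<alpha> t < 1 / real (Suc K)"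
    by (rule order_tendstoD(2)[OF \<alpha>(2)]) simp
  then obtain T where T: "\<And>t. T \<le> t \<Longrightarrow> \<alpha> t < 1 / real (Suc K)"
    by (auto simp: eventually_sequentially)
  show ?thesis
    \<comment> \<open>From this \<open>n\<close> on, the block index is at least \<open>T\<close>,
      and at least 1, where \<alpha> is known to be positive.\<close>
    using eventually_ge_at_top[of "ns (max T 1)"]
  proof eventually_elim
    case (elim n)
    let ?t = "block_index ns n"
    have t: "max T 1 \<le> ?t"
      using block_index_ge[OF ns _ elim] by simp
    then have "real K * \<alpha> ?t \<le> real (Suc K) * \<alpha> ?t"
      using \<alpha>(1)[of ?t] by (intro mult_right_mono) auto
    also have "\<dots> \<le> 1"
      using T[of ?t] t by (simp add: field_simps)
    finally have "real K \<le> 1 / \<alpha> ?t"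
      using \<alpha>(1)[of ?t] t by (simp add: field_simps)
    then show ?case
      by (simp add: ennreal_of_nat_eq_real_of_nat ennreal_leI)
  qed
qed

section \<open>From diameters to rates of convergence\<close>

lemma dist_le_ediam:
  assumes "x \<in> I" "y \<in> I"
  shows "ennreal (dist x y) \<le> ediam I"
  unfolding ediam_def using assms by (auto intro: SUP_upper2)

lemma dist_bigo_of_ediam:
  fixes x :: "nat \<Rightarrow> 'p::metric_space"
  assumes "\<forall>\<^sub>F n in sequentially. x n \<in> I n" "\<forall>\<^sub>F n in sequentially. y \<in> I n"
    and "ennreal_bigo (\<lambda>n. ediam (I n)) r"
  shows "(\<lambda>n. dist (x n) y) \<in> O(r)"
proof -
  obtain c where c: "c > 0" "\<forall>\<^sub>F n in sequentially. ediam (I n) \<le> ennreal (c * \<bar>r n\<bar>)"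
    using assms(3) by (auto simp: ennreal_bigo_def)
  have "\<forall>\<^sub>F n in sequentially. norm (dist (x n) y) \<le> c * norm (r n)"
    using assms(1,2) c(2)
  proof eventually_elim
    case (elim n)
    with dist_le_ediam[of "x n" "I n" y] have "ennreal (dist (x n) y) \<le> ennreal (c * \<bar>r n\<bar>)"
      by (blast intro: order_trans)
    \<comment> \<open>As \<open>c > 0\<close>, the right-hand side is the image of a nonnegative
      real, so the inequality descends to the reals.\<close>
    then show ?case
      using c(1) by simp
  qed
  then show ?thesis
    by (rule bigoI)
qed

lemma dist_smallo_of_ediam:
  fixes x :: "nat \<Rightarrow> 'p::metric_space"
  assumes "\<forall>\<^sub>F n in sequentially. x n \<in> I n" "\<forall>\<^sub>F n in sequentially. y \<in> I n"
    and "ennreal_smallo (\<lambda>n. ediam (I n)) r"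
  shows "(\<lambda>n. dist (x n) y) \<in> o(r)"
proof (rule landau_o.smallI)
  fix c :: real
  assume c: "c > 0"
  then have "\<forall>\<^sub>F n in sequentially. ediam (I n) \<le> ennreal (c * \<bar>r n\<bar>)"
    using assms(3) by (auto simp: ennreal_smallo_def)
  with assms(1,2) show "\<forall>\<^sub>F n in sequentially. norm (dist (x n) y) \<le> c * norm (r n)"
  proof eventually_elim
    case (elim n)
    with dist_le_ediam[of "x n" "I n" y] have "ennreal (dist (x n) y) \<le> ennreal (c * \<bar>r n\<bar>)"
      by (blast intro: order_trans)
    then show ?case
      using c by simp
  qed
qed

theorem theorem2p5:
  fixes S :: "'a measure"
    and \<Theta> :: "'p::metric_space set"
    and \<P> :: "'p \<Rightarrow> 'a measure set"
    and \<theta>star :: 'p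
    and Pstar :: "'a measure"
    and W :: "'w measure"
    and X :: "nat \<Rightarrow> 'w \<Rightarrow> 'a"
    and M :: "'p \<Rightarrow> nat \<Rightarrow> (nat \<Rightarrow> 'a) \<Rightarrow> ennreal"
    and \<theta>est :: "nat \<Rightarrow> 'w \<Rightarrow> 'p"
    and ns :: "nat \<Rightarrow> nat"
    and \<alpha> :: "nat \<Rightarrow> real"
  defines "CS \<equiv> (\<lambda>n w. CS_star \<Theta> M ns \<alpha> n (data X w))"
  assumes model: "\<And>\<theta> P. \<theta> \<in> \<Theta> \<Longrightarrow> P \<in> \<P> \<theta> \<Longrightarrow> prob_space P \<and> sets P = sets S"
    and truth: "\<theta>star \<in> \<Theta>" "Pstar \<in> \<P> \<theta>star"
    and iid: "iid_from W X Pstar"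
    and e_proc: "\<And>\<theta>. \<theta> \<in> \<Theta> \<Longrightarrow> e_process S (\<P> \<theta>) (M \<theta>)"
    and ME: "\<And>n w. 1 \<le> n \<Longrightarrow> w \<in> space W \<Longrightarrow>
               is_arg_min (\<lambda>\<theta>. M \<theta> n (data X w)) (\<lambda>\<theta>. \<theta> \<in> \<Theta>) (\<theta>est n w)"
    and ns: "ns 1 = 1" "strict_mono_on {1..} ns"
    and \<alpha>: "\<And>t. 1 \<le> t \<Longrightarrow> 0 < \<alpha> t" "strict_antimono_on {1..} \<alpha>" "\<alpha> \<longlonglongrightarrow> 0"
  shows "almost_sure_confidence_sets W CS \<theta>star \<and>
    (AE w in W. \<forall>\<^sub>F n in sequentially. \<theta>star \<in> CS n w) \<and>
    (AE w in W. \<forall>\<^sub>F n in sequentially. \<theta>est n w \<in> CS n w) \<and>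
    (\<forall>r. (\<forall>n\<ge>1. 0 < r n) \<longrightarrow>
       (AE w in W. ennreal_bigo (\<lambda>n. ediam (CS n w)) r \<longrightarrow>
          (\<lambda>n. dist (\<theta>est n w) \<theta>star) \<in> O(r)) \<and>
       (AE w in W. ennreal_smallo (\<lambda>n. ediam (CS n w)) r \<longrightarrow>
          (\<lambda>n. dist (\<theta>est n w) \<theta>star) \<in> o(r)))"
proof -
  have "AE x in distr W (PiM {1..} (\<lambda>_. Pstar)) (data X). \<exists>K. \<forall>n\<ge>1. M \<theta>star n x \<le> of_nat K"
    unfolding iid_from_distr_data(2)[OF iid]
    by (rule AE_e_process_bounded[OF e_proc[OF truth(1)] truth(2)])
      (use model[OF truth] in simp)
  then have bounded: "AE w in W. \<exists>K. \<forall>n\<ge>1. M \<theta>star n (data X w) \<le> of_nat K"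
    by (rule AE_distrD[OF iid_from_distr_data(1)[OF iid]])
  \<comment> \<open>This part is deterministic: along a single path bounded by \<open>K\<close>,
    coverage holds as soon as the threshold has reached \<open>K\<close>.\<close>
  have covered: "(\<forall>\<^sub>F n in sequentially. \<theta>star \<in> CS n w) \<and> (\<forall>\<^sub>F n in sequentially. \<theta>est n w \<in> CS n w)"
    if w: "w \<in> space W" and K: "\<forall>n\<ge>1. M \<theta>star n (data X w) \<le> of_nat K" for w K
  proof -
    have "\<forall>\<^sub>F n in sequentially. of_nat K \<le> ennreal (1 / \<alpha> (block_index ns n))"
      using \<alpha>(1,3) by (rule eventually_le_inverse_block_level[OF ns])
    then have "\<forall>\<^sub>F n in sequentially. \<theta>star \<in> CS n w \<and> \<theta>est n w \<in> CS n w"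
      using eventually_ge_at_top[of 1]
    proof eventually_elim
      case (elim n)
      have "M \<theta>star n (data X w) \<le> ennreal (1 / \<alpha> (block_index ns n))"
        using K elim by (blast intro: order_trans)
      \<comment> \<open>The true parameter competes in the minimisation, so the minimum inherits its
        bound.\<close>
      moreover have "\<theta>est n w \<in> \<Theta>" "M (\<theta>est n w) n (data X w) \<le> M \<theta>star n (data X w)"
        using ME[OF elim(2) w] truth(1) by (auto simp: is_arg_min_def not_less)
      ultimately show ?case
        using truth(1) by (auto simp: CS_def CS_star_def)
    qed
    then show ?thesis
      by (simp add: eventually_conj_iff)
  qed
  have star: "AE w in W. \<forall>\<^sub>F n in sequentially. \<theta>star \<in> CS n w"
    using bounded AE_space by eventually_elim (use covered in blast)
  have est: "AE w in W. \<forall>\<^sub>F n in sequentially. \<theta>est n w \<in> CS n w"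
    using bounded AE_space by eventually_elim (use covered in blast)
  have "almost_sure_confidence_sets W CS \<theta>star"
    unfolding almost_sure_confidence_sets_def using star
  proof eventually_elim
    case (elim w)
    then obtain N where "\<forall>n\<ge>N. \<theta>star \<in> CS n w"
      by (auto simp: eventually_sequentially)
    then show ?case
      \<comment> \<open>The 2 accounts for the requirement \<open>N > 1\<close> in the
        definition.\<close>
      by (intro exI[of _ "max N 2"]) auto
  qed
  moreover have "AE w in W. ennreal_bigo (\<lambda>n. ediam (CS n w)) r \<longrightarrow>
      (\<lambda>n. dist (\<theta>est n w) \<theta>star) \<in> O(r)" for r
    using star est by eventually_elim (intro impI dist_bigo_of_ediam)
  moreover have "AE w in W. ennreal_smallo (\<lambda>n. ediam (CS n w)) r \<longrightarrow>
      (\<lambda>n. dist (\<theta>est n w) \<theta>star) \<in> o(r)" for r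
    using star est by eventually_elim (intro impI dist_smallo_of_ediam)
  ultimately show ?thesis
    using star est by blast
qed

end
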